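(* Let $n\ge 1$, let $H$ be a nonzero $2^n\times 2^n$ complex matrix, let $P_R,P_L$ be state-preparation oracles for $H$, and let $U_{\mathrm{FOX}}=(P_L^\dagger\otimes I_n)\cdot \mathrm{SELECT}\cdot (P_R\otimes I_n)$ be the corresponding FOQCS-LCU circuit on $3n$ qubits (all as defined in the context). If the $2n$ ancilla qubits are prepared in $|0\rangle_{2n}$, then the controlled application of $U_{\mathrm{FOX}}$ can be realized by controlling only $P_R$ and $P_L^\dagger$: for every state $|c\rangle=\alpha|0\rangle+\beta|1\rangle$ of the control qubit and every $n$-qubit system state $|\varphi\rangle$, $$\Lambda(U_{\mathrm{FOX}})\,|c\rangle|0\rangle_{2n}|\varphi\rangle=\Lambda(P_L^\dagger\otimes I_n)\,(I_1\otimes \mathrm{SELECT})\,\Lambda(P_R\otimes I_n)\,|c\rangle|0\rangle_{2n}|\varphi\rangle .$$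
   Context: $I_m$ is the identity on $m$ qubits and $|0\rangle_m$ the all-zero state of $m$ qubits. For a unitary $V$, $\Lambda(V)=|0\rangle\langle 0|\otimes I+|1\rangle\langle 1|\otimes V$ is the controlled-$V$ gate with one (first) control qubit. For $i\in\{0,\dots,2^n-1\}$ with bits $\mathtt i_0,\dots,\mathtt i_{n-1}$, $|i\rangle=|\mathtt i_0\rangle\otimes\cdots\otimes|\mathtt i_{n-1}\rangle$. $X,Z$ are the Pauli matrices. Every $2^n\times 2^n$ matrix $H$ is written as $H=\sum_{i,j=0}^{2^n-1}\alpha_{ij}\bigotimes_{\ell=0}^{n-1}Z^{\mathtt j_\ell}X^{\mathtt i_\ell}$ with $\alpha_{ij}\in\mathbb C$. Put $\mathcal N=\sum_{i,j}|\alpha_{ij}|$. State-preparation oracles for $H$ are unitaries $P_R,P_L$ on $2n$ qubits with $$P_R|0\rangle_{2n}=\tfrac1{\sqrt{\mathcal N}}\sum_{i,j}e^{\mathrm i\arg\alpha_{ij}}\sqrt{|\alpha_{ij}|}\,|i\rangle|j\rangle,\qquad P_L|0\rangle_{2n}=\tfrac1{\sqrt{\mathcal N}}\sum_{i,j}\sqrt{|\alpha_{ij}|}\,|i\rangle|j\rangle .$$ $\mathrm{SELECT}$ acts on three $n$-qubit registers: first $n$ CNOT gates (the $\ell$-th qubit of the first register controls an $X$ on the $\ell$-th qubit of the third), then $n$ CZ gates (between the $\ell$-th qubits of the second and third registers); i.e. $\mathrm{SELECT}\,|i\rangle|j\rangle|\varphi\rangle=|i\rangle|j\rangle\otimes\big(\bigotimes_{\ell}Z^{\mathtt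 j_\ell}X^{\mathtt i_\ell}\big)|\varphi\rangle$. *)

theory Defs
  imports Complex_Main "Jordan_Normal_Form.Schur_Decomposition"
begin

section \<open>Tensor products\<close>

definition tensor_vec :: "complex vec \<Rightarrow> complex vec \<Rightarrow> complex vec" (infixr \<open>\<otimes>\<^sub>v\<close> 75) where
  "u \<otimes>\<^sub>v v = vec (dim_vec u * dim_vec v) (\<lambda>k. u $ (k div dim_vec v) * v $ (k mod dim_vec v))"

definition tensor_mat :: "complex mat \<Rightarrow> complex mat \<Rightarrow> complex mat" (infixr \<open>\<otimes>\<^sub>m\<close> 75) where
  "A \<otimes>\<^sub>m B = mat (dim_row A * dim_row B) (dim_col A * dim_col B)
     (\<lambda>(r, c). A $$ (r div dim_row B, c div dim_col B) * B $$ (r mod dim_row B, c mod dim_col B))"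

definition tensor_vecs :: "nat \<Rightarrow> (nat \<Rightarrow> complex vec) \<Rightarrow> complex vec" where
  "tensor_vecs m f = foldr (\<lambda>l v. f l \<otimes>\<^sub>v v) [0..<m] (unit_vec 1 0)"

definition tensor_mats :: "nat \<Rightarrow> (nat \<Rightarrow> complex mat) \<Rightarrow> complex mat" where
  "tensor_mats m f = foldr (\<lambda>l A. f l \<otimes>\<^sub>m A) [0..<m] (1\<^sub>m 1)"

lemma dim_tensor_mat [simp]:
  "dim_row (A \<otimes>\<^sub>m B) = dim_row A * dim_row B"
  "dim_col (A \<otimes>\<^sub>m B) = dim_col A * dim_col B"
  by (simp_all add: tensor_mat_def)

lemma dim_tensor_vec [simp]: "dim_vec (u \<otimes>\<^sub>v v) = dim_vec u * dim_vec v"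
  by (simp add: tensor_vec_def)

lemma tensor_mats_carrier:
  assumes "\<And>l. l < m \<Longrightarrow> f l \<in> carrier_mat 2 2"
  shows "tensor_mats m f \<in> carrier_mat (2 ^ m) (2 ^ m)"
proof -
  have "foldr (\<lambda>l A. f l \<otimes>\<^sub>m A) ls (1\<^sub>m 1) \<in> carrier_mat (2 ^ length ls) (2 ^ length ls)"
    if "set ls \<subseteq> {..<m}" for ls
    using that
  proof (induction ls)
    case (Cons l ls)
    then have "f l \<in> carrier_mat 2 2"
      using assms by auto
    with Cons show ?case
      by (auto intro!: carrier_matI)
  qed auto
  from this [of "[0..<m]"] show ?thesis
    by (simp add: tensor_mats_def atLeast0LessThan)
qed

lemma tensor_vecs_carrier:
  assumes "\<And>l. l < m \<Longrightarrow> f l \<in> carrier_vec 2"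
  shows "tensor_vecs m f \<in> carrier_vec (2 ^ m)"
proof -
  have "foldr (\<lambda>l v. f l \<otimes>\<^sub>v v) ls (unit_vec 1 0) \<in> carrier_vec (2 ^ length ls)"
    if "set ls \<subseteq> {..<m}" for ls
    using that
  proof (induction ls)
    case (Cons l ls)
    then have "f l \<in> carrier_vec 2"
      using assms by auto
    with Cons show ?case
      by (auto intro!: carrier_vecI)
  qed auto
  from this [of "[0..<m]"] show ?thesis
    by (simp add: tensor_vecs_def atLeast0LessThan)
qed


section \<open>Qubits, states and gates\<close>

(* Bit l of an n-bit index, where bit 0 is the most significant one; with this choice
   ket n i is the i-th standard basis vector. *)
definition qbit :: "nat \<Rightarrow> nat \<Rightarrow> nat \<Rightarrow> nat" where
  "qbit n i l = (i div 2 ^ (n - 1 - l)) mod 2"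

definition ket :: "nat \<Rightarrow> nat \<Rightarrow> complex vec" where
  "ket n i = tensor_vecs n (\<lambda>l. unit_vec 2 (qbit n i l))"

abbreviation ket_zero :: "nat \<Rightarrow> complex vec" where
  "ket_zero m \<equiv> ket m 0"

abbreviation id_qubits :: "nat \<Rightarrow> complex mat" where
  "id_qubits m \<equiv> 1\<^sub>m (2 ^ m)"

definition is_state :: "nat \<Rightarrow> complex vec \<Rightarrow> bool" where
  "is_state m v \<longleftrightarrow> v \<in> carrier_vec (2 ^ m) \<and> v \<bullet>c v = 1"

definition is_unitary :: "nat \<Rightarrow> complex mat \<Rightarrow> bool" where
  "is_unitary m U \<longleftrightarrow> U \<in> carrier_mat (2 ^ m) (2 ^ m) \<and>
     mat_adjoint U * U = id_qubits m \<and> U * mat_adjoint U = id_qubits m"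

definition outer_prod :: "complex vec \<Rightarrow> complex vec \<Rightarrow> complex mat" where
  "outer_prod u v = mat (dim_vec u) (dim_vec v) (\<lambda>(r, c). u $ r * conjugate (v $ c))"

(* The projector onto the basis state b of a single qubit. *)
abbreviation proj :: "nat \<Rightarrow> complex mat" where
  "proj b \<equiv> outer_prod (ket 1 b) (ket 1 b)"

definition pauli_X :: "complex mat" where
  "pauli_X = mat_of_rows_list 2 [[0, 1], [1, 0]]"

definition pauli_Z :: "complex mat" where
  "pauli_Z = mat_of_rows_list 2 [[1, 0], [0, -1]]"

definition controlled :: "complex mat \<Rightarrow> complex mat" (\<open>\<Lambda>\<close>) where
  "\<Lambda> V = proj 0 \<otimes>\<^sub>m 1\<^sub>m (dim_row V) + proj 1 \<otimes>\<^sub>m V"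

(* Single-qubit gate G on qubit t of an m-qubit system, controlled by qubit c. *)
definition cgate :: "nat \<Rightarrow> complex mat \<Rightarrow> nat \<Rightarrow> nat \<Rightarrow> complex mat" where
  "cgate m G c t =
     tensor_mats m (\<lambda>q. if q = c then proj 0 else id_qubits 1) +
     tensor_mats m (\<lambda>q. if q = c then proj 1 else if q = t then G else id_qubits 1)"

(* Unitary of a circuit on m qubits; the head of the list is applied first. *)
definition circuit :: "nat \<Rightarrow> complex mat list \<Rightarrow> complex mat" where
  "circuit m gs = foldl (\<lambda>U G. G * U) (id_qubits m) gs"


section \<open>The FOQCS-LCU circuit\<close>

definition pauli_string :: "nat \<Rightarrow> nat \<Rightarrow> nat \<Rightarrow> complex mat" where
  "pauli_string n i j = tensor_mats n (\<lambda>l. pauli_Z ^\<^sub>m qbit n j l * pauli_X ^\<^sub>m qbit n i l)"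

definition pauli_sum :: "nat \<Rightarrow> (nat \<Rightarrow> nat \<Rightarrow> complex) \<Rightarrow> complex mat" where
  "pauli_sum n \<alpha> = finsum (module_mat TYPE(complex) (2 ^ n) (2 ^ n))
     (\<lambda>(i, j). \<alpha> i j \<cdot>\<^sub>m pauli_string n i j) ({..<2 ^ n} \<times> {..<2 ^ n})"

definition coeff_norm :: "nat \<Rightarrow> (nat \<Rightarrow> nat \<Rightarrow> complex) \<Rightarrow> real" where
  "coeff_norm n \<alpha> = (\<Sum>i<2 ^ n. \<Sum>j<2 ^ n. cmod (\<alpha> i j))"

definition is_prep_R :: "nat \<Rightarrow> (nat \<Rightarrow> nat \<Rightarrow> complex) \<Rightarrow> complex mat \<Rightarrow> bool" where
  "is_prep_R n \<alpha> P \<longleftrightarrow> is_unitary (2 * n) P \<and>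
     P *\<^sub>v ket_zero (2 * n) = complex_of_real (1 / sqrt (coeff_norm n \<alpha>)) \<cdot>\<^sub>v
       finsum_vec TYPE(complex) (2 ^ (2 * n))
         (\<lambda>(i, j). (exp (\<i> * complex_of_real (Arg (\<alpha> i j))) * complex_of_real (sqrt (cmod (\<alpha> i j))))
            \<cdot>\<^sub>v (ket n i \<otimes>\<^sub>v ket n j))
         ({..<2 ^ n} \<times> {..<2 ^ n})"

definition is_prep_L :: "nat \<Rightarrow> (nat \<Rightarrow> nat \<Rightarrow> complex) \<Rightarrow> complex mat \<Rightarrow> bool" where
  "is_prep_L n \<alpha> P \<longleftrightarrow> is_unitary (2 * n) P \<and>
     P *\<^sub>v ket_zero (2 * n) = complex_of_real (1 / sqrt (coeff_norm n \<alpha>)) \<cdot>\<^sub>v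
       finsum_vec TYPE(complex) (2 ^ (2 * n))
         (\<lambda>(i, j). complex_of_real (sqrt (cmod (\<alpha> i j))) \<cdot>\<^sub>v (ket n i \<otimes>\<^sub>v ket n j))
         ({..<2 ^ n} \<times> {..<2 ^ n})"

definition SELECT :: "nat \<Rightarrow> complex mat" where
  "SELECT n = circuit (3 * n)
     (map (\<lambda>l. cgate (3 * n) pauli_X l (2 * n + l)) [0..<n] @
      map (\<lambda>l. cgate (3 * n) pauli_Z (n + l) (2 * n + l)) [0..<n])"

definition U_FOX :: "nat \<Rightarrow> complex mat \<Rightarrow> complex mat \<Rightarrow> complex mat" where
  "U_FOX n P\<^sub>R P\<^sub>L =
     (mat_adjoint P\<^sub>L \<otimes>\<^sub>m id_qubits n) * SELECT n * (P\<^sub>R \<otimes>\<^sub>m id_qubits n)"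


(* The carrier facts below make finsum and finsum_vec above genuine sums. *)

lemma pauli_string_carrier: "pauli_string n i j \<in> carrier_mat (2 ^ n) (2 ^ n)"
  unfolding pauli_string_def
proof (rule tensor_mats_carrier)
  fix l
  have "pauli_Z \<in> carrier_mat 2 2" "pauli_X \<in> carrier_mat 2 2"
    by (auto simp: pauli_Z_def pauli_X_def mat_of_rows_list_def intro!: carrier_matI)
  then show "pauli_Z ^\<^sub>m qbit n j l * pauli_X ^\<^sub>m qbit n i l \<in> carrier_mat 2 2"
    by (meson mult_carrier_mat pow_carrier_mat)
qed

lemma ket_carrier: "ket n i \<in> carrier_vec (2 ^ n)"
  unfolding ket_def by (rule tensor_vecs_carrier) simp

lemma ket_tensor_carrier: "ket n i \<otimes>\<^sub>v ket n j \<in> carrier_vec (2 ^ (2 * n))"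
  using ket_carrier [of n i] ket_carrier [of n j]
  by (auto intro!: carrier_vecI simp: power_add mult_2)

end

theory Submission
  imports Defs
begin

text \<open>Every gate of SELECT is controlled by one of the ancilla qubits, so SELECT acts trivially on
  \<open>|0\<rangle>\<^sub>2\<^sub>n \<otimes> |\<phi>\<rangle>\<close>. Hence, in the branch where the control qubit is \<open>0\<close> and neither
  preparation oracle fires, the uncontrolled SELECT does nothing, while in the other branch
  all three factors of \<open>U\<^sub>F\<^sub>O\<^sub>X\<close> are applied.\<close>

section \<open>Tensor products\<close>

text \<open>Division with remainder by \<open>n\<close> is a bijection between
  \<open>{..<m * n}\<close> and pairs of indices. It turns the single sum in a matrix-vector product
  of tensors into a double sum that factors.\<close>

lemma sum_divmod:
  fixes f :: "nat \<Rightarrow> nat \<Rightarrow> 'a::comm_monoid_add"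
  shows "(\<Sum>k<m * n. f (k div n) (k mod n)) = (\<Sum>i<m. \<Sum>j<n. f i j)"
proof -
  have "(\<Sum>k<m * n. f (k div n) (k mod n)) = (\<Sum>(i, j)\<in>{..<m} \<times> {..<n}. f i j)"
  proof (rule sum.reindex_bij_witness[where j = "\<lambda>k. (k div n, k mod n)" and i = "\<lambda>(i, j). i * n + j"])
    fix k assume "k \<in> {..<m * n}"
    then show "(k div n, k mod n) \<in> {..<m} \<times> {..<n}"
      by (cases "n = 0") (auto simp: less_mult_imp_div_less)
  next
    fix p assume "p \<in> {..<m} \<times> {..<n}"
    then obtain i j where "p = (i, j)" "i < m" "j < n"
      by auto
    \<comment> \<open>The intermediate bound is the start of the block after block \<open>i\<close>,
      which ends no later than \<open>m * n\<close>.\<close>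
    moreover from \<open>i < m\<close> \<open>j < n\<close> have "i * n + j < Suc i * n" "Suc i * n \<le> m * n"
      by (auto intro: mult_le_mono1 simp del: mult_Suc) simp
    ultimately show "(case p of (i, j) \<Rightarrow> i * n + j) \<in> {..<m * n}"
      by simp
  qed auto
  then show ?thesis
    by (simp add: sum.cartesian_product)
qed

lemma tensor_mat_carrier:
  assumes "A \<in> carrier_mat m n" "B \<in> carrier_mat p q"
  shows "A \<otimes>\<^sub>m B \<in> carrier_mat (m * p) (n * q)"
  using assms by (auto intro!: carrier_matI)

lemma tensor_vec_carrier:
  assumes "u \<in> carrier_vec m" "v \<in> carrier_vec n"
  shows "u \<otimes>\<^sub>v v \<in> carrier_vec (m * n)"
  using assms by (auto intro!: carrier_vecI)

text \<open>Each entry of the left side is a sum over pairs \<open>(i, j)\<close> of a term in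
  \<open>i\<close> times a term in \<open>j\<close>, hence a product of two scalar products. Only
  the inner dimensions have to match.\<close>

lemma tensor_mat_mult_vec:
  assumes "dim_col A = dim_vec u" "dim_col B = dim_vec v"
  shows "(A \<otimes>\<^sub>m B) *\<^sub>v (u \<otimes>\<^sub>v v) = (A *\<^sub>v u) \<otimes>\<^sub>v (B *\<^sub>v v)"
proof (rule eq_vecI)
  fix r assume "r < dim_vec ((A *\<^sub>v u) \<otimes>\<^sub>v (B *\<^sub>v v))"
  then have r: "r < dim_row A * dim_row B"
    by simp
  \<comment> \<open>The existence of an index \<open>r\<close> in range rules out
    \<open>dim_row B = 0\<close>, where the bound on the remainder would fail.\<close>
  then have rA: "r div dim_row B < dim_row A" and rB: "r mod dim_row B < dim_row B"
    by (auto simp: less_mult_imp_div_less) (metis gr0I mult_0_right mod_less_divisor not_less0)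
  let ?F = "\<lambda>i j. (A $$ (r div dim_row B, i) * u $ i) * (B $$ (r mod dim_row B, j) * v $ j)"
  have "((A \<otimes>\<^sub>m B) *\<^sub>v (u \<otimes>\<^sub>v v)) $ r
      = (\<Sum>k<dim_vec u * dim_vec v. ?F (k div dim_vec v) (k mod dim_vec v))"
    using r assms
    by (simp add: tensor_mat_def tensor_vec_def scalar_prod_def atLeast0LessThan mult_ac)
  also have "\<dots> = (\<Sum>i<dim_vec u. \<Sum>j<dim_vec v. ?F i j)"
    by (rule sum_divmod)
  also have "\<dots> = ((A *\<^sub>v u) \<otimes>\<^sub>v (B *\<^sub>v v)) $ r"
    using r rA rB assms
    by (simp add: tensor_vec_def scalar_prod_def atLeast0LessThan sum_product)
  finally show "((A \<otimes>\<^sub>m B) *\<^sub>v (u \<otimes>\<^sub>v v)) $ r = ((A *\<^sub>v u) \<otimes>\<^sub>v (B *\<^sub>v v)) $ r" .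
qed simp

text \<open>Either bracketing reads \<open>k\<close> as the same three-digit number in mixed radix,
  so it suffices to compare the digits.\<close>

lemma tensor_vec_assoc: "(u \<otimes>\<^sub>v v) \<otimes>\<^sub>v w = u \<otimes>\<^sub>v (v \<otimes>\<^sub>v w)"
proof (rule eq_vecI)
  fix k assume "k < dim_vec (u \<otimes>\<^sub>v (v \<otimes>\<^sub>v w))"
  then have k: "k < dim_vec u * dim_vec v * dim_vec w"
    by (simp add: mult.assoc)
  then have pos: "dim_vec v * dim_vec w > 0"
    by (metis mult.assoc gr0I mult_0_right not_less0)
  have "k div dim_vec w < dim_vec u * dim_vec v"
    using k by (rule less_mult_imp_div_less)
  moreover have "k mod (dim_vec v * dim_vec w) < dim_vec v * dim_vec w"
    using pos by simp
  moreover have "k div dim_vec w div dim_vec v = k div (dim_vec v * dim_vec w)"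
    by (simp add: mult.commute[of "dim_vec v"] div_mult2_eq)
  \<comment> \<open>The remainder modulo the product consists of the two lower digits: it has the
    form \<open>q * m + r\<close> with \<open>r < m\<close>, from which both are recovered.\<close>
  moreover have "k mod (dim_vec v * dim_vec w) div dim_vec w = k div dim_vec w mod dim_vec v"
      "k mod (dim_vec v * dim_vec w) mod dim_vec w = k mod dim_vec w"
  proof -
    have "k mod (dim_vec v * dim_vec w) =
        k div dim_vec w mod dim_vec v * dim_vec w + k mod dim_vec w"
      by (simp add: mult.commute[of "dim_vec v"] mod_mult2_eq)
    moreover have "k mod dim_vec w < dim_vec w"
      using pos by simp
    moreover have "(q * m + r) div m = q" "(q * m + r) mod m = r" if "r < m" for q m r :: nat
      using that by simp_all
    ultimately show "k mod (dim_vec v * dim_vec w) div dim_vec w = k div dim_vec w mod dim_vec v"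
      "k mod (dim_vec v * dim_vec w) mod dim_vec w = k mod dim_vec w"
      by (simp_all only:)
  qed
  ultimately show "((u \<otimes>\<^sub>v v) \<otimes>\<^sub>v w) $ k = (u \<otimes>\<^sub>v (v \<otimes>\<^sub>v w)) $ k"
    using k by (simp add: tensor_vec_def mult.assoc)
qed (simp add: mult.assoc)

lemma tensor_vec_add_left:
  assumes "dim_vec u = dim_vec v"
  shows "(u + v) \<otimes>\<^sub>v w = u \<otimes>\<^sub>v w + v \<otimes>\<^sub>v w"
  using assms
  by (intro eq_vecI) (auto simp: tensor_vec_def less_mult_imp_div_less distrib_right)

lemma tensor_vec_zero_left: "0\<^sub>v m \<otimes>\<^sub>v v = 0\<^sub>v (m * dim_vec v)"
  by (intro eq_vecI) (auto simp: tensor_vec_def less_mult_imp_div_less)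

lemma tensor_vec_zero_right: "u \<otimes>\<^sub>v 0\<^sub>v n = 0\<^sub>v (dim_vec u * n)"
proof (intro eq_vecI)
  fix k assume "k < dim_vec (0\<^sub>v (dim_vec u * n) :: complex vec)"
  then have "k < dim_vec u * n" "n > 0"
    by (auto intro: gr0I)
  then show "(u \<otimes>\<^sub>v 0\<^sub>v n) $ k = 0\<^sub>v (dim_vec u * n) $ k"
    by (simp add: tensor_vec_def)
qed simp

lemma tensor_unit_vec_left [simp]: "unit_vec (Suc 0) 0 \<otimes>\<^sub>v v = v"
  by (intro eq_vecI) (auto simp: tensor_vec_def)

lemma tensor_unit_vec_right [simp]: "v \<otimes>\<^sub>v unit_vec (Suc 0) 0 = v"
  by (intro eq_vecI) (auto simp: tensor_vec_def)

text \<open>Indices are equal exactly when their quotients and remainders by \<open>n\<close> are,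
  so two Kronecker deltas multiply to one.\<close>

lemma tensor_one_mat [simp]: "1\<^sub>m m \<otimes>\<^sub>m 1\<^sub>m n = 1\<^sub>m (m * n)"
proof (rule eq_matI)
  fix i j assume "i < dim_row (1\<^sub>m (m * n) :: complex mat)" "j < dim_col (1\<^sub>m (m * n) :: complex mat)"
  then have ij: "i < m * n" "j < m * n" and "n > 0"
    by (auto intro: gr0I)
  have "i = j" if "i div n = j div n" "i mod n = j mod n"
    using that by (metis div_mult_mod_eq)
  with ij \<open>n > 0\<close> show "(1\<^sub>m m \<otimes>\<^sub>m 1\<^sub>m n) $$ (i, j) = 1\<^sub>m (m * n) $$ (i, j)"
    by (auto simp: tensor_mat_def less_mult_imp_div_less)
qed auto

section \<open>Tensor products folded over a list of qubits\<close>

lemma foldr_tensor_mat_carrier: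
  assumes "\<And>l. l \<in> set ls \<Longrightarrow> f l \<in> carrier_mat 2 2" "M \<in> carrier_mat p q"
  shows "foldr (\<lambda>l A. f l \<otimes>\<^sub>m A) ls M \<in> carrier_mat (2 ^ length ls * p) (2 ^ length ls * q)"
  using assms(1)
proof (induction ls)
  case (Cons l ls)
  then have "f l \<otimes>\<^sub>m foldr (\<lambda>l A. f l \<otimes>\<^sub>m A) ls M
      \<in> carrier_mat (2 * (2 ^ length ls * p)) (2 * (2 ^ length ls * q))"
    by (intro tensor_mat_carrier) auto
  then show ?case
    by (simp add: mult.assoc)
qed (simp add: assms(2))

lemma foldr_tensor_vec_carrier:
  assumes "\<And>l. l \<in> set ls \<Longrightarrow> g l \<in> carrier_vec 2" "v \<in> carrier_vec p"
  shows "foldr (\<lambda>l v. g l \<otimes>\<^sub>v v) ls v \<in> carrier_vec (2 ^ length ls * p)"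
  using assms(1)
proof (induction ls)
  case (Cons l ls)
  then have "g l \<otimes>\<^sub>v foldr (\<lambda>l v. g l \<otimes>\<^sub>v v) ls v \<in> carrier_vec (2 * (2 ^ length ls * p))"
    by (intro tensor_vec_carrier) auto
  then show ?case
    by (simp add: mult.assoc)
qed (simp add: assms(2))

text \<open>The mixed-product rule applied qubit by qubit. The arbitrary seeds \<open>M\<close> and
  \<open>v\<close> stand for the remaining qubits, whose state may be entangled and so need not be a
  product.\<close>

lemma foldr_tensor_mult_vec:
  assumes "\<And>l. l \<in> set ls \<Longrightarrow> f l \<in> carrier_mat 2 2"
    and "\<And>l. l \<in> set ls \<Longrightarrow> g l \<in> carrier_vec 2"
    and "M \<in> carrier_mat p q" "v \<in> carrier_vec q"
  shows "foldr (\<lambda>l A. f l \<otimes>\<^sub>m A) ls M *\<^sub>v foldr (\<lambda>l v. g l \<otimes>\<^sub>v v) ls v =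
    foldr (\<lambda>l v. (f l *\<^sub>v g l) \<otimes>\<^sub>v v) ls (M *\<^sub>v v)"
  using assms(1,2)
proof (induction ls)
  case (Cons l ls)
  have "foldr (\<lambda>l A. f l \<otimes>\<^sub>m A) ls M \<in> carrier_mat (2 ^ length ls * p) (2 ^ length ls * q)"
    "foldr (\<lambda>l v. g l \<otimes>\<^sub>v v) ls v \<in> carrier_vec (2 ^ length ls * q)"
    using Cons.prems assms(3,4)
    by (auto intro!: foldr_tensor_mat_carrier foldr_tensor_vec_carrier)
  moreover have "dim_col (f l) = 2" "dim_vec (g l) = 2"
    using Cons.prems by (metis carrier_matD(2) carrier_vecD list.set_intros(1))+
  ultimately show ?case
    using Cons by (simp add: tensor_mat_mult_vec)
qed simp

text \<open>One zero factor annihilates the whole product, whether it stands at the head or inside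
  the tail.\<close>

lemma foldr_tensor_vec_zero:
  assumes "c \<in> set ls" "g c = 0\<^sub>v 2"
    and "\<And>l. l \<in> set ls \<Longrightarrow> g l \<in> carrier_vec 2" "v \<in> carrier_vec p"
  shows "foldr (\<lambda>l v. g l \<otimes>\<^sub>v v) ls v = 0\<^sub>v (2 ^ length ls * p)"
  using assms(1,3)
proof (induction ls)
  case (Cons l ls)
  show ?case
  proof (cases "l = c")
    case True
    have "foldr (\<lambda>l v. g l \<otimes>\<^sub>v v) ls v \<in> carrier_vec (2 ^ length ls * p)"
      using Cons.prems assms(4) by (intro foldr_tensor_vec_carrier) auto
    then show ?thesis
      using True assms(2) by (simp add: tensor_vec_zero_left mult.assoc)
  next
    case False
    then have "foldr (\<lambda>l v. g l \<otimes>\<^sub>v v) ls v = 0\<^sub>v (2 ^ length ls * p)"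
      using Cons by simp
    moreover have "dim_vec (g l) = 2"
      using Cons.prems by (metis carrier_vecD list.set_intros(1))
    ultimately show ?thesis
      by (simp add: tensor_vec_zero_right mult.assoc)
  qed
qed simp

lemma foldr_tensor_one_mat:
  assumes "\<And>l. l \<in> set ls \<Longrightarrow> f l = 1\<^sub>m 2"
  shows "foldr (\<lambda>l A. f l \<otimes>\<^sub>m A) ls (1\<^sub>m 1) = 1\<^sub>m (2 ^ length ls)"
  using assms by (induction ls) auto

section \<open>Controlled gates\<close>

text \<open>Stated with \<open>Suc 0\<close> because the simplifier normalises \<open>1\<close> to
  it; the later uses of \<open>unfolded One_nat_def\<close> serve the same purpose.\<close>

lemma ket_1: "b < 2 \<Longrightarrow> ket (Suc 0) b = unit_vec 2 b"
  by (simp add: ket_def tensor_vecs_def qbit_def)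

text \<open>All bits of 0 are 0, and associativity lets \<open>v\<close> replace the trivial seed of
  the fold. This is the shape that \<open>foldr_tensor_mult_vec\<close> expects, with the system
  state as seed.\<close>

lemma ket_zero_tensor: "ket_zero m \<otimes>\<^sub>v v = foldr (\<lambda>l. (\<otimes>\<^sub>v) (unit_vec 2 0)) [0..<m] v"
proof -
  have "foldr (\<lambda>l. (\<otimes>\<^sub>v) (unit_vec 2 0)) ls (unit_vec 1 0) \<otimes>\<^sub>v v =
      foldr (\<lambda>l. (\<otimes>\<^sub>v) (unit_vec 2 0)) ls v" for ls :: "nat list"
    by (induction ls) (auto simp: tensor_vec_assoc)
  then show ?thesis
    by (simp add: ket_def tensor_vecs_def qbit_def)
qed

lemma proj_carrier: "b < 2 \<Longrightarrow> proj b \<in> carrier_mat 2 2"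
  by (auto simp: outer_prod_def ket_1 intro!: carrier_matI)

lemma proj_mult_unit_vec:
  assumes "b < 2" "b' < 2"
  shows "proj b *\<^sub>v unit_vec 2 b' = (if b = b' then unit_vec 2 b else 0\<^sub>v 2)"
  using assms by (intro eq_vecI) (auto simp: outer_prod_def ket_1 scalar_prod_def numeral_2_eq_2 less_Suc_eq)

text \<open>The control lies among the first \<open>k\<close> qubits, which are all |0>. Hence the
  summand of the gate with \<open>proj 0\<close> acts as the identity and the summand with
  \<open>proj 1\<close> vanishes, whatever \<open>G\<close> is.\<close>

lemma cgate_ket_zero:
  assumes G: "G \<in> carrier_mat 2 2" and c: "c < k" and t: "k \<le> t" and \<phi>: "\<phi> \<in> carrier_vec (2 ^ r)"
  shows "cgate (k + r) G c t *\<^sub>v (ket_zero k \<otimes>\<^sub>v \<phi>) = ket_zero k \<otimes>\<^sub>v \<phi>"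
proof -
  let ?w = "ket_zero k \<otimes>\<^sub>v \<phi>"
  define f where "f = (\<lambda>q. if q = c then proj 0 else id_qubits 1)"
  define g where "g = (\<lambda>q. if q = c then proj 1 else if q = t then G else id_qubits 1)"
  have f: "f q \<in> carrier_mat 2 2" and g: "g q \<in> carrier_mat 2 2" for q
    using proj_carrier G by (auto simp: f_def g_def)
  have f0: "f q *\<^sub>v unit_vec 2 0 = unit_vec 2 0" for q
    by (simp add: f_def proj_mult_unit_vec[unfolded One_nat_def])
  have g0: "g c *\<^sub>v unit_vec 2 0 = 0\<^sub>v 2"
    by (simp add: g_def proj_mult_unit_vec[unfolded One_nat_def])
  \<comment> \<open>The fold is cut between the \<open>k\<close> zero qubits and the
    \<open>r\<close> qubits carrying \<open>\<phi>\<close>.\<close>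
  have split: "tensor_mats (k + r) h =
      foldr (\<lambda>l A. h l \<otimes>\<^sub>m A) [0..<k] (foldr (\<lambda>l A. h l \<otimes>\<^sub>m A) [k..<k + r] (1\<^sub>m 1))" for h
    by (simp add: tensor_mats_def upt_add_eq_append[of 0 k r, simplified] del: upt_Suc)
  have w: "?w \<in> carrier_vec (2 ^ (k + r))"
    using tensor_vec_carrier[OF ket_carrier \<phi>] by (simp add: power_add)
  \<comment> \<open>Since \<open>c < k\<close>, the control does not occur in this range and every
    factor of \<open>f\<close> is an identity.\<close>
  have fr: "foldr (\<lambda>l A. f l \<otimes>\<^sub>m A) [k..<k + r] (1\<^sub>m 1) = 1\<^sub>m (2 ^ r)"
    using c by (subst foldr_tensor_one_mat) (auto simp: f_def)
  have gr: "foldr (\<lambda>l A. g l \<otimes>\<^sub>m A) [k..<k + r] (1\<^sub>m 1) \<in> carrier_mat (2 ^ r) (2 ^ r)"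
    using foldr_tensor_mat_carrier[of "[k..<k + r]" g "1\<^sub>m 1" 1 1] g by simp
  have "tensor_mats (k + r) f *\<^sub>v ?w = ?w"
    unfolding split fr ket_zero_tensor
    by (subst foldr_tensor_mult_vec[where p = "2 ^ r" and q = "2 ^ r"]) (use f \<phi> in \<open>auto simp: f0\<close>)
  moreover have "tensor_mats (k + r) g *\<^sub>v ?w = 0\<^sub>v (2 ^ (k + r))"
  proof -
    have "tensor_mats (k + r) g *\<^sub>v ?w =
        foldr (\<lambda>l v. (g l *\<^sub>v unit_vec 2 0) \<otimes>\<^sub>v v) [0..<k]
          (foldr (\<lambda>l A. g l \<otimes>\<^sub>m A) [k..<k + r] (1\<^sub>m 1) *\<^sub>v \<phi>)"
      unfolding split ket_zero_tensor
      by (rule foldr_tensor_mult_vec) (use g gr \<phi> in auto)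
    \<comment> \<open>The factor at \<open>c\<close> is \<open>proj 1\<close> applied to |0>, which
      is zero; of the tail only its dimension matters.\<close>
    also have "\<dots> = 0\<^sub>v (2 ^ length [0..<k] * 2 ^ r)"
      by (rule foldr_tensor_vec_zero[where c = c])
        (use c g g0 gr \<phi> in \<open>auto intro!: mult_mat_vec_carrier[of _ 2 2] mult_mat_vec_carrier[of _ "2 ^ r" "2 ^ r"]\<close>)
    finally show ?thesis
      by (simp add: power_add)
  qed
  moreover have "tensor_mats (k + r) f \<in> carrier_mat (2 ^ (k + r)) (2 ^ (k + r))"
    "tensor_mats (k + r) g \<in> carrier_mat (2 ^ (k + r)) (2 ^ (k + r))"
    using f g by (auto intro: tensor_mats_carrier)
  moreover have "cgate (k + r) G c t = tensor_mats (k + r) f + tensor_mats (k + r) g"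
    by (simp add: cgate_def f_def g_def)
  ultimately show ?thesis
    using w by (simp add: add_mult_distrib_mat_vec)
qed

lemma cgate_carrier:
  assumes "G \<in> carrier_mat 2 2"
  shows "cgate m G c t \<in> carrier_mat (2 ^ m) (2 ^ m)"
  unfolding cgate_def using assms proj_carrier
  by (intro add_carrier_mat tensor_mats_carrier) auto

section \<open>Circuits and SELECT\<close>

lemma circuit_carrier:
  assumes "set gs \<subseteq> carrier_mat (2 ^ m) (2 ^ m)"
  shows "circuit m gs \<in> carrier_mat (2 ^ m) (2 ^ m)"
  using assms by (induction gs rule: rev_induct) (auto simp: circuit_def)

text \<open>Later gates multiply from the left, so the last gate is the outermost factor; this is
  why the induction peels the list from its end.\<close>

lemma circuit_fixes:
  assumes "set gs \<subseteq> carrier_mat (2 ^ m) (2 ^ m)" "w \<in> carrier_vec (2 ^ m)"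
    and "\<And>G. G \<in> set gs \<Longrightarrow> G *\<^sub>v w = w"
  shows "circuit m gs *\<^sub>v w = w"
  using assms(1,3)
proof (induction gs rule: rev_induct)
  case Nil
  then show ?case
    using assms(2) by (simp add: circuit_def)
next
  case (snoc G gs)
  have "circuit m (gs @ [G]) *\<^sub>v w = (G * circuit m gs) *\<^sub>v w"
    by (simp add: circuit_def)
  also have "\<dots> = G *\<^sub>v (circuit m gs *\<^sub>v w)"
    using snoc.prems assms(2) circuit_carrier[of gs m] by (intro assoc_mult_mat_vec) auto
  also have "\<dots> = w"
    using snoc by simp
  finally show ?case .
qed

lemma pauli_carrier: "pauli_X \<in> carrier_mat 2 2" "pauli_Z \<in> carrier_mat 2 2"
  by (auto simp: pauli_X_def pauli_Z_def mat_of_rows_list_def intro!: carrier_matI)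

lemma SELECT_carrier: "SELECT n \<in> carrier_mat (2 ^ (3 * n)) (2 ^ (3 * n))"
  unfolding SELECT_def by (rule circuit_carrier) (auto intro!: cgate_carrier pauli_carrier)

lemma SELECT_ket_zero:
  assumes "\<phi> \<in> carrier_vec (2 ^ n)"
  shows "SELECT n *\<^sub>v (ket_zero (2 * n) \<otimes>\<^sub>v \<phi>) = ket_zero (2 * n) \<otimes>\<^sub>v \<phi>"
  unfolding SELECT_def
proof (rule circuit_fixes)
  \<comment> \<open>The split into \<open>2 * n\<close> ancilla and \<open>n\<close> system qubits
    gives the form \<open>k + r\<close> of \<open>cgate_ket_zero\<close>.\<close>
  have 3: "3 * n = 2 * n + n"
    by simp
  show "ket_zero (2 * n) \<otimes>\<^sub>v \<phi> \<in> carrier_vec (2 ^ (3 * n))"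
    using tensor_vec_carrier[OF ket_carrier assms] by (simp only: 3 power_add)
  fix G
  assume "G \<in> set (map (\<lambda>l. cgate (3 * n) pauli_X l (2 * n + l)) [0..<n] @
    map (\<lambda>l. cgate (3 * n) pauli_Z (n + l) (2 * n + l)) [0..<n])"
  \<comment> \<open>CNOT and CZ gates are brought to one form: their controls \<open>l\<close> and
    \<open>n + l\<close> both lie below \<open>2 * n\<close> because \<open>l < n\<close>.\<close>
  then obtain P c l where "G = cgate (2 * n + n) P c (2 * n + l)" "P \<in> carrier_mat 2 2" "c < 2 * n"
    using pauli_carrier unfolding 3 by fastforce
  then show "G *\<^sub>v (ket_zero (2 * n) \<otimes>\<^sub>v \<phi>) = ket_zero (2 * n) \<otimes>\<^sub>v \<phi>"
    using assms by (simp only: cgate_ket_zero le_add1)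
qed (auto intro!: cgate_carrier pauli_carrier)

section \<open>Controlled operators on the two branches of the control qubit\<close>

lemma controlled_carrier:
  assumes "V \<in> carrier_mat d d"
  shows "\<Lambda> V \<in> carrier_mat (2 * d) (2 * d)"
  unfolding controlled_def using assms proj_carrier
  by (intro add_carrier_mat tensor_mat_carrier) auto

text \<open>By linearity each projector selects one branch. The branches carry separate vectors
  \<open>u\<close> and \<open>v\<close>, since they differ once the first controlled gate has
  acted.\<close>

lemma controlled_mult_vec:
  assumes V: "V \<in> carrier_mat d d" and "u \<in> carrier_vec d" "v \<in> carrier_vec d"
  shows "\<Lambda> V *\<^sub>v ((a \<cdot>\<^sub>v ket 1 0) \<otimes>\<^sub>v u + (b \<cdot>\<^sub>v ket 1 1) \<otimes>\<^sub>v v) =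
    (a \<cdot>\<^sub>v ket 1 0) \<otimes>\<^sub>v u + (b \<cdot>\<^sub>v ket 1 1) \<otimes>\<^sub>v (V *\<^sub>v v)"
proof -
  have p: "proj 0 *\<^sub>v (a \<cdot>\<^sub>v ket 1 0) = a \<cdot>\<^sub>v ket 1 0" "proj 0 *\<^sub>v (b \<cdot>\<^sub>v ket 1 1) = 0\<^sub>v 2"
    "proj 1 *\<^sub>v (a \<cdot>\<^sub>v ket 1 0) = 0\<^sub>v 2" "proj 1 *\<^sub>v (b \<cdot>\<^sub>v ket 1 1) = b \<cdot>\<^sub>v ket 1 1"
    by (intro eq_vecI; auto simp: outer_prod_def ket_1 scalar_prod_def numeral_2_eq_2 less_Suc_eq)+
  have k: "a \<cdot>\<^sub>v ket 1 0 \<in> carrier_vec 2" "b \<cdot>\<^sub>v ket 1 1 \<in> carrier_vec 2"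
    by (simp_all add: ket_1)
  have c: "proj 0 \<otimes>\<^sub>m 1\<^sub>m d \<in> carrier_mat (2 * d) (2 * d)" "proj 1 \<otimes>\<^sub>m V \<in> carrier_mat (2 * d) (2 * d)"
    using V proj_carrier by (auto intro!: tensor_mat_carrier)
  have w: "(a \<cdot>\<^sub>v ket 1 0) \<otimes>\<^sub>v u \<in> carrier_vec (2 * d)" "(b \<cdot>\<^sub>v ket 1 1) \<otimes>\<^sub>v v \<in> carrier_vec (2 * d)"
    "(b \<cdot>\<^sub>v ket 1 1) \<otimes>\<^sub>v (V *\<^sub>v v) \<in> carrier_vec (2 * d)"
    using k assms by (auto intro!: tensor_vec_carrier)
  have t: "(proj b \<otimes>\<^sub>m M) *\<^sub>v (x \<otimes>\<^sub>v y) = (proj b *\<^sub>v x) \<otimes>\<^sub>v (M *\<^sub>v y)"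
    if "b < 2" "x \<in> carrier_vec 2" "y \<in> carrier_vec d" "M \<in> carrier_mat d d" for b x y M
    using that proj_carrier[of b] by (intro tensor_mat_mult_vec) auto
  let ?e0 = "a \<cdot>\<^sub>v ket 1 0" and ?e1 = "b \<cdot>\<^sub>v ket 1 1"
  have u: "1\<^sub>m d *\<^sub>v u = u"
    using assms by auto
  have "\<Lambda> V *\<^sub>v (?e0 \<otimes>\<^sub>v u + ?e1 \<otimes>\<^sub>v v) =
      (proj 0 \<otimes>\<^sub>m 1\<^sub>m d) *\<^sub>v (?e0 \<otimes>\<^sub>v u + ?e1 \<otimes>\<^sub>v v) + (proj 1 \<otimes>\<^sub>m V) *\<^sub>v (?e0 \<otimes>\<^sub>v u + ?e1 \<otimes>\<^sub>v v)"
    unfolding controlled_def carrier_matD(1)[OF V]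
    using c w by (intro add_mult_distrib_mat_vec) auto
  \<comment> \<open>\<open>proj 0\<close> removes the branch of \<open>ket 1 1\<close> and leaves
    the other one unchanged.\<close>
  also have "(proj 0 \<otimes>\<^sub>m 1\<^sub>m d) *\<^sub>v (?e0 \<otimes>\<^sub>v u + ?e1 \<otimes>\<^sub>v v) = ?e0 \<otimes>\<^sub>v u + 0\<^sub>v (2 * d)"
    using assms k
    by (simp only: mult_add_distrib_mat_vec[OF c(1) w(1,2)] t[OF _ _ _ one_carrier_mat] p u
        tensor_vec_zero_left) (simp add: tensor_vec_zero_left)
  also have "(proj 1 \<otimes>\<^sub>m V) *\<^sub>v (?e0 \<otimes>\<^sub>v u + ?e1 \<otimes>\<^sub>v v) = 0\<^sub>v (2 * d) + ?e1 \<otimes>\<^sub>v (V *\<^sub>v v)"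
    using assms k
    by (simp add: mult_add_distrib_mat_vec[OF c(2) w(1,2), unfolded One_nat_def]
        t[unfolded One_nat_def] p[unfolded One_nat_def] tensor_vec_zero_left)
  finally show ?thesis
    using w by simp
qed

theorem theorem1:
  fixes n :: nat
    and H P\<^sub>R P\<^sub>L :: "complex mat"
    and \<alpha> :: "nat \<Rightarrow> nat \<Rightarrow> complex"
    and a b :: complex
    and c \<phi> :: "complex vec"
  assumes "n \<ge> 1"
    and "H \<in> carrier_mat (2 ^ n) (2 ^ n)"
    and "H \<noteq> 0\<^sub>m (2 ^ n) (2 ^ n)"
    and "H = pauli_sum n \<alpha>"
    and "is_prep_R n \<alpha> P\<^sub>R"
    and "is_prep_L n \<alpha> P\<^sub>L"
    and "c = a \<cdot>\<^sub>v ket 1 0 + b \<cdot>\<^sub>v ket 1 1"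
    and "is_state 1 c"
    and "is_state n \<phi>"
  shows "\<Lambda> (U_FOX n P\<^sub>R P\<^sub>L) *\<^sub>v (c \<otimes>\<^sub>v ket_zero (2 * n) \<otimes>\<^sub>v \<phi>) =
    (\<Lambda> (mat_adjoint P\<^sub>L \<otimes>\<^sub>m id_qubits n) * (id_qubits 1 \<otimes>\<^sub>m SELECT n) * \<Lambda> (P\<^sub>R \<otimes>\<^sub>m id_qubits n))
      *\<^sub>v (c \<otimes>\<^sub>v ket_zero (2 * n) \<otimes>\<^sub>v \<phi>)"
proof -
  define d :: nat where "d = 2 ^ (3 * n)"
  define A where "A = mat_adjoint P\<^sub>L \<otimes>\<^sub>m id_qubits n"
  define B where "B = P\<^sub>R \<otimes>\<^sub>m id_qubits n"
  define S where "S = SELECT n"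
  define w where "w = ket_zero (2 * n) \<otimes>\<^sub>v \<phi>"
  let ?e0 = "a \<cdot>\<^sub>v ket 1 0" and ?e1 = "b \<cdot>\<^sub>v ket 1 1"
  have d: "d = 2 ^ (2 * n) * 2 ^ n"
    by (simp add: d_def flip: power_add)
  have \<phi>: "\<phi> \<in> carrier_vec (2 ^ n)"
    using assms by (simp add: is_state_def)
  have A: "A \<in> carrier_mat d d" and B: "B \<in> carrier_mat d d"
    using assms(5,6) unfolding A_def B_def d is_prep_R_def is_prep_L_def is_unitary_def
    by (auto intro!: tensor_mat_carrier simp: mat_adjoint_def)
  have S: "S \<in> carrier_mat d d"
    by (simp add: S_def d_def SELECT_carrier)
  have w: "w \<in> carrier_vec d"
    unfolding w_def d by (intro tensor_vec_carrier ket_carrier \<phi>)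
  \<comment> \<open>Here, and only here, it matters that the ancillas are all zero.\<close>
  have Sw: "S *\<^sub>v w = w"
    unfolding S_def w_def by (rule SELECT_ket_zero[OF \<phi>])
  have e: "?e0 \<in> carrier_vec 2" "?e1 \<in> carrier_vec 2"
    by (simp_all add: ket_1)
  \<comment> \<open>Initially both branches carry the same vector \<open>w\<close>.\<close>
  have cw: "c \<otimes>\<^sub>v w = ?e0 \<otimes>\<^sub>v w + ?e1 \<otimes>\<^sub>v w"
    using e by (simp add: assms(7) tensor_vec_add_left)
  have Bw: "B *\<^sub>v w \<in> carrier_vec d" and SBw: "S *\<^sub>v (B *\<^sub>v w) \<in> carrier_vec d"
    using S B w by auto
  have ew: "?e0 \<otimes>\<^sub>v w \<in> carrier_vec (2 * d)" "?e1 \<otimes>\<^sub>v (B *\<^sub>v w) \<in> carrier_vec (2 * d)"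
    using e w Bw by (auto intro!: tensor_vec_carrier)
  have IS: "id_qubits 1 \<otimes>\<^sub>m S \<in> carrier_mat (2 * d) (2 * d)"
    using S by (intro tensor_mat_carrier) auto
  have ISe: "(id_qubits 1 \<otimes>\<^sub>m S) *\<^sub>v (x \<otimes>\<^sub>v y) = x \<otimes>\<^sub>v (S *\<^sub>v y)"
    if "x \<in> carrier_vec 2" "y \<in> carrier_vec d" for x y
    using that S by (subst tensor_mat_mult_vec) auto
  have "(\<Lambda> A * (id_qubits 1 \<otimes>\<^sub>m S) * \<Lambda> B) *\<^sub>v (c \<otimes>\<^sub>v w) =
      \<Lambda> A *\<^sub>v ((id_qubits 1 \<otimes>\<^sub>m S) *\<^sub>v (\<Lambda> B *\<^sub>v (c \<otimes>\<^sub>v w)))"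
  proof -
    have "c \<otimes>\<^sub>v w \<in> carrier_vec (2 * d)"
      using e w by (auto simp: assms(7) intro!: tensor_vec_carrier)
    then show ?thesis
      using controlled_carrier[OF A] controlled_carrier[OF B] IS
      by (simp add: assoc_mult_mat_vec[of _ "2 * d" "2 * d" _ "2 * d"])
  qed
  also have "\<dots> = \<Lambda> A *\<^sub>v ((id_qubits 1 \<otimes>\<^sub>m S) *\<^sub>v (?e0 \<otimes>\<^sub>v w + ?e1 \<otimes>\<^sub>v (B *\<^sub>v w)))"
    by (simp only: cw controlled_mult_vec[OF B w w])
  \<comment> \<open>The uncontrolled \<open>S\<close> acts on both branches; in the idle one it
    meets \<open>w\<close> itself, which it fixes.\<close>
  also have "\<dots> = \<Lambda> A *\<^sub>v (?e0 \<otimes>\<^sub>v w + ?e1 \<otimes>\<^sub>v (S *\<^sub>v (B *\<^sub>v w)))"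
    by (simp only: mult_add_distrib_mat_vec[OF IS ew] ISe[OF e(1) w] ISe[OF e(2) Bw] Sw)
  also have "\<dots> = ?e0 \<otimes>\<^sub>v w + ?e1 \<otimes>\<^sub>v (A *\<^sub>v (S *\<^sub>v (B *\<^sub>v w)))"
    by (rule controlled_mult_vec[OF A w SBw])
  also have "A *\<^sub>v (S *\<^sub>v (B *\<^sub>v w)) = (A * S * B) *\<^sub>v w"
    using A S B w by (simp add: assoc_mult_mat_vec[of _ d d _ d])
  \<comment> \<open>The branch rule, read backwards for the product \<open>A * S * B\<close>,
    reassembles the fully controlled circuit.\<close>
  also have "?e0 \<otimes>\<^sub>v w + ?e1 \<otimes>\<^sub>v ((A * S * B) *\<^sub>v w) = \<Lambda> (A * S * B) *\<^sub>v (c \<otimes>\<^sub>v w)"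
    unfolding cw by (rule controlled_mult_vec[symmetric]) (use A S B w in auto)
  finally show ?thesis
    by (simp add: U_FOX_def A_def B_def S_def w_def)
qed

end
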